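(* Let $\Gamma$ be a connected threshold graph on $n$ vertices with binary string $b$. Then $\Gamma$ has (a) two distinct normalized eigenvalues if and only if $b=01^{n-1}$; (b) three distinct normalized eigenvalues if and only if $b=0^{n-1}1$; (c) four distinct normalized eigenvalues if and only if $b=0^s1^{n-s}$ with $1<s<n-1$, or $b=01^{n-3}01$.
   Context: Binary strings: a threshold graph with binary string $b=b_1\ldots b_n$ (where $b_1=0$) is the simple graph on vertices $1,\dots,n$ built by adding vertices in order, vertex $i\ge 2$ being added as an isolated vertex if $b_i=0$ and as a dominating vertex (adjacent to all earlier vertices) if $b_i=1$. A connected threshold graph on $n\ge 2$ vertices has $b_n=1$, and its string is written $0^{s_1}1^{t_1}\cdots0^{s_k}1^{t_k}$ with $k\ge1$ and all exponents positive integers; here $0^a$, $1^a$ denote $a$ consecutive symbols. Exponents in all strings above are positive integers. The normalized eigenvalues of $\Gamma$ are the eigenvalues of its normalized adjacency matrix $\mathcal{A}=D^{-1}A$, where $A$ is the adjacency matrix and $D$ the diagonal matrix of vertex degrees.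
   Formalization: In (b) the condition n ≥ 3 is added to b = 0^{n-1}1, because for n = 2 the string 01 gives K_2, which has only the two normalized eigenvalues 1 and -1. *)

theory Defs
  imports "Graph_Theory.Graph_Theory" "Jordan_Normal_Form.Spectral_Radius"
    "Jordan_Normal_Form.Gauss_Jordan_Elimination"
begin

text \<open>
  Binary strings are lists of Booleans, with \<open>False\<close> for the symbol 0 and \<open>True\<close> for the
  symbol 1. The letter \<open>b\<^sub>i\<close> of the mathematical notation (1-based) is \<open>b ! (i - 1)\<close>.
\<close>

abbreviation zeros :: "nat \<Rightarrow> bool list" where
  "zeros a \<equiv> replicate a False"

abbreviation ones :: "nat \<Rightarrow> bool list" where
  "ones a \<equiv> replicate a True"

text \<open>
  Simple graphs are loop-free symmetric digraphs without parallel arcs (locale \<open>pair_graph\<close>);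
  every edge is stored as two opposite arcs. The vertices are \<open>1, ..., n\<close>, so the vertex added
  to a graph on \<open>m\<close> vertices is \<open>m + 1\<close>.
\<close>

definition add_vertex :: "nat pair_pre_digraph \<Rightarrow> bool \<Rightarrow> nat pair_pre_digraph" where
  "add_vertex G x =
    (let v = Suc (card (pverts G))
     in \<lparr> pverts = insert v (pverts G),
          parcs = parcs G \<union> (if x then pverts G \<times> {v} \<union> {v} \<times> pverts G else {}) \<rparr>)"

text \<open>
  The construction starts from the graph without vertices, where adding an isolated and adding a
  dominating vertex coincide; this is why the first symbol of a string is normalised to 0.
\<close>

definition threshold_graph :: "bool list \<Rightarrow> nat pair_pre_digraph" where
  "threshold_graph b = foldl add_vertex \<lparr> pverts = {}, parcs = {} \<rparr> b"

text \<open>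
  The following matrices are meant for graphs with vertex set \<open>{1..n}\<close>. Matrix indices start at
  0, so index \<open>i\<close> belongs to vertex \<open>i + 1\<close>. The entries are taken in the complex numbers, so
  that eigenvalues are a priori complex.
\<close>

definition adjacency_matrix :: "nat pair_pre_digraph \<Rightarrow> complex mat" where
  "adjacency_matrix G =
    mat (card (pverts G)) (card (pverts G))
      (\<lambda>(i, j). if (Suc i, Suc j) \<in> parcs G then 1 else 0)"

definition degree_matrix :: "nat pair_pre_digraph \<Rightarrow> complex mat" where
  "degree_matrix G =
    mat (card (pverts G)) (card (pverts G))
      (\<lambda>(i, j). if i = j then of_nat (out_degree (with_proj G) (Suc i)) else 0)"

text \<open>
  The inverse of the degree matrix exists iff there are no isolated vertices, in particular for
  connected graphs on at least two vertices.
\<close>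

definition normalized_adjacency_matrix :: "nat pair_pre_digraph \<Rightarrow> complex mat" where
  "normalized_adjacency_matrix G = the (mat_inverse (degree_matrix G)) * adjacency_matrix G"

definition normalized_eigenvalues :: "nat pair_pre_digraph \<Rightarrow> complex set" where
  "normalized_eigenvalues G = spectrum (normalized_adjacency_matrix G)"

lemma threshold_graph_Nil: "threshold_graph [] = \<lparr> pverts = {}, parcs = {} \<rparr>"
  by (simp add: threshold_graph_def)

lemma threshold_graph_snoc: "threshold_graph (b @ [x]) = add_vertex (threshold_graph b) x"
  by (simp add: threshold_graph_def)

lemma pverts_threshold_graph: "pverts (threshold_graph b) = {1..length b}"
  by (induction b rule: rev_induct)
     (auto simp: threshold_graph_Nil threshold_graph_snoc add_vertex_def Let_def)

lemma parcs_threshold_graph: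
  "parcs (threshold_graph b) =
    {(i, j). i \<in> {1..length b} \<and> j \<in> {1..length b} \<and> i \<noteq> j \<and> b ! (max i j - 1)}"
proof (induction b rule: rev_induct)
  case Nil
  show ?case by (simp add: threshold_graph_Nil)
next
  case (snoc x b)
  show ?case
    unfolding threshold_graph_snoc add_vertex_def Let_def pverts_threshold_graph
    by (auto simp: snoc.IH nth_append max_def le_Suc_eq split: if_splits)
qed

lemma pair_graph_threshold_graph: "pair_graph (threshold_graph b)"
proof
  show "finite (parcs (threshold_graph b))"
    by (rule finite_subset[of _ "{1..length b} \<times> {1..length b}"])
       (auto simp: parcs_threshold_graph)
  show "symmetric (with_proj (threshold_graph b))"
    by (auto simp: symmetric_def sym_def parcs_threshold_graph max.commute)
qed (auto simp: pverts_threshold_graph parcs_threshold_graph)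

lemma normalized_adjacency_matrix_entries:
  assumes deg: "\<And>i. i < card (pverts G) \<Longrightarrow> out_degree (with_proj G) (Suc i) \<noteq> 0"
  shows "normalized_adjacency_matrix G =
    mat (card (pverts G)) (card (pverts G))
      (\<lambda>(i, j). if (Suc i, Suc j) \<in> parcs G
                then 1 / of_nat (out_degree (with_proj G) (Suc i)) else 0)"
proof -
  define n where "n = card (pverts G)"
  define d where "d i = (of_nat (out_degree (with_proj G) (Suc i)) :: complex)" for i
  have d0: "d i \<noteq> 0" if "i < n" for i
    using deg that by (simp add: d_def n_def)
  define E where "E = mat n n (\<lambda>(i, j). if i = j then 1 / d i else 0)"
  have D: "degree_matrix G = mat n n (\<lambda>(i, j). if i = j then d i else 0)"
    by (simp add: degree_matrix_def n_def d_def cong: if_cong)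
  have Dc: "degree_matrix G \<in> carrier_mat n n" and Ec: "E \<in> carrier_mat n n"
    by (simp_all add: D E_def)
  have DE: "degree_matrix G * E = 1\<^sub>m n"
    by (rule eq_matI)
       (auto simp: D E_def scalar_prod_def d0 if_distrib[of "\<lambda>x. x * _"] cong: if_cong)
  have ED: "E * degree_matrix G = 1\<^sub>m n"
    by (rule eq_matI)
       (auto simp: D E_def scalar_prod_def d0 if_distrib[of "\<lambda>x. x * _"] cong: if_cong)
  have "degree_matrix G \<in> Units (ring_mat TYPE(complex) n ())"
    unfolding Units_def using Dc Ec DE ED by (auto simp: ring_mat_def)
  then obtain B where B: "mat_inverse (degree_matrix G) = Some B"
    using mat_inverse(1)[OF Dc, where b = "()"] by (cases "mat_inverse (degree_matrix G)") auto
  then have B1: "B * degree_matrix G = 1\<^sub>m n" and Bc: "B \<in> carrier_mat n n"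
    using mat_inverse(2)[OF Dc] by auto
  have "B = B * (degree_matrix G * E)" using Bc DE by simp
  also have "\<dots> = (B * degree_matrix G) * E" using Bc Dc Ec by (simp add: assoc_mult_mat)
  finally have "B = E" using B1 Ec by simp
  then have "normalized_adjacency_matrix G = E * adjacency_matrix G"
    by (simp add: normalized_adjacency_matrix_def B)
  also have "\<dots> = mat n n (\<lambda>(i, j). if (Suc i, Suc j) \<in> parcs G then 1 / d i else 0)"
    by (rule eq_matI)
       (auto simp: E_def adjacency_matrix_def n_def[symmetric] scalar_prod_def
          if_distrib[of "\<lambda>x. x * _"] cong: if_cong)
  finally show ?thesis by (simp add: n_def d_def cong: if_cong)
qed

end

theory Submission
  imports Defs
begin

text \<open>
  The first two vertices of a threshold graph are twins whatever their letters are. Read the string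
  with its first letter replaced by the second, and let \<open>m\<close> be the number of its runs. The
  vertices of a run are twins (adjacent to each other iff the letter is 1), so the runs, called
  cells below, form an equitable partition. An eigenvector of \<open>D\<^sup>-\<^sup>1A\<close> takes equal values on twins
  unless its eigenvalue is 0 (for a cell of letter 0) or \<open>- 1 / d\<close> (for a cell of letter 1 with
  vertices of degree \<open>d\<close>), and differences of twins are eigenvectors for these values. Hence
  the spectrum consists of the spectrum of the \<open>m \<times> m\<close> quotient matrix and of these special values for all cells with at least two vertices (\<open>spectrum_vertex_matrix\<close>).

  The main point is that the quotient matrix has exactly \<open>m\<close> eigenvalues
  (\<open>card_spectrum_quotient\<close>). It is symmetrizable, hence diagonalizable, so the claim is that its
  eigenspaces are lines. This follows as soon as one linear functional is injective on each of them,
  and the size-weighted total is such a functional (\<open>eigenvector_eq_0_if_total_0\<close>). Indeed,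
  the neighbourhood sums of an eigenvector satisfy a three-term recurrence, which determines the
  eigenvector from its total, working from the last cell to the first, as long as its eigenvalue is
  not a special value. The special value 0 is excluded directly. For the others, the recurrence is
  run from the first cell, where it produces alternating signs and hence no zeros
  (\<open>nbsum_alternates\<close>).

  Finally, 0 and the special value of the last cell are never eigenvalues of the quotient matrix,
  and neither is that of the first cell if \<open>m = 3\<close>. As the first cell has at least two vertices,
  this gives 2 eigenvalues for one cell; 3 or 4 eigenvalues for two cells, depending on whether
  the second cell has a single vertex; 4 eigenvalues for three cells if the last two are single
  vertices and at least 5 otherwise; at least \<open>4 + 1\<close> eigenvalues for four cells, as the first
  cell contributes 0; and at least \<open>m\<close> eigenvalues in general.
\<close>

section \<open>Symmetrizable matrices with simple eigenvalues\<close>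

text \<open>
  Eigenvectors are handled below as plain functions on indices, which spares all carrier conditions.
\<close>

lemma eigenvalue_iff_function:
  fixes A :: "complex mat"
  assumes "A \<in> carrier_mat n n"
  shows "eigenvalue A \<mu> \<longleftrightarrow>
    (\<exists>x. (\<exists>i<n. x i \<noteq> 0) \<and> (\<forall>i<n. (\<Sum>j<n. A $$ (i, j) * x j) = \<mu> * x i))"
    (is "_ \<longleftrightarrow> ?R")
proof
  have mv: "(A *\<^sub>v v) $ i = (\<Sum>j<n. A $$ (i, j) * v $ j)"
    if "v \<in> carrier_vec n" "i < n" for v i
    using that assms by (simp add: scalar_prod_def atLeast0LessThan)
  { assume "eigenvalue A \<mu>"
    then obtain v where v: "v \<in> carrier_vec n" "v \<noteq> 0\<^sub>v n" "A *\<^sub>v v = \<mu> \<cdot>\<^sub>v v"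
      using assms by (auto simp: eigenvalue_def eigenvector_def)
    have "\<exists>i<n. v $ i \<noteq> 0" using v(1,2) by (auto simp: vec_eq_iff)
    moreover have "(\<Sum>j<n. A $$ (i, j) * v $ j) = \<mu> * v $ i" if "i < n" for i
      using mv[OF v(1) that] v(1,3) that by simp
    ultimately show ?R by (intro exI[of _ "\<lambda>i. v $ i"]) auto }
  { assume ?R
    then obtain x where x: "\<exists>i<n. x i \<noteq> 0"
        "\<And>i. i < n \<Longrightarrow> (\<Sum>j<n. A $$ (i, j) * x j) = \<mu> * x i" by auto
    have "vec n x \<noteq> 0\<^sub>v n" using x(1) by (auto simp: vec_eq_iff)
    moreover have "A *\<^sub>v vec n x = \<mu> \<cdot>\<^sub>v vec n x"
      by (rule eq_vecI, insert assms x(2) mv[of "vec n x"], auto simp del: index_mult_mat_vec)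
    ultimately show "eigenvalue A \<mu>"
      using assms by (auto simp: eigenvalue_def eigenvector_def intro!: exI[of _ "vec n x"]) }
qed

text \<open>
  If there are fewer eigenvalues than rows, some eigenvalue \<open>\<mu>\<close> is a multiple root of the
  characteristic polynomial. In a Schur triangularisation that lists \<open>\<mu>\<close> in the first two
  diagonal places, the first two basis vectors are the desired \<open>x\<close> and \<open>y\<close>.
\<close>

lemma generalized_eigenvector_of_double_root:
  fixes A :: "complex mat"
  assumes A: "A \<in> carrier_mat m m" and "card (spectrum A) \<noteq> m"
  obtains \<mu> c x y where
    "\<And>k. k < m \<Longrightarrow> (\<Sum>l<m. A $$ (k, l) * x l) = \<mu> * x k"
    "\<And>k. k < m \<Longrightarrow> (\<Sum>l<m. A $$ (k, l) * y l) = \<mu> * y k + c * x k"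
    "\<And>\<alpha> \<beta>. (\<And>k. k < m \<Longrightarrow> \<alpha> * x k + \<beta> * y k = 0) \<Longrightarrow> \<alpha> = 0 \<and> \<beta> = 0"
proof -
  obtain es where es: "char_poly A = (\<Prod>e\<leftarrow>es. [:- e, 1:])" "length es = m"
    using char_poly_factorized[OF A] by auto
  have "spectrum A = set es"
    unfolding spectrum_root_char_poly[OF A] es(1)
    by (auto simp: poly_prod_list prod_list_zero_iff)
  then have "\<not> distinct es" using assms(2) es(2) distinct_card by auto
  then obtain xs ys zs \<mu> where "es = xs @ [\<mu>] @ ys @ [\<mu>] @ zs"
    using not_distinct_decomp by blast
  \<comment> \<open>The eigenvalues may appear on the diagonal of a triangular form in any order.\<close>
  then have cp: "char_poly A = (\<Prod>e\<leftarrow>\<mu> # \<mu> # xs @ ys @ zs. [:- e, 1:])"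
    and len: "m = length (\<mu> # \<mu> # xs @ ys @ zs)"
    using es by (auto simp del: mult_pCons_left mult_pCons_right simp: mult_ac)
  obtain B P Q where "schur_decomposition A (\<mu> # \<mu> # xs @ ys @ zs) = (B, P, Q)"
    using prod_cases3 by blast
  from schur_decomposition[OF A cp this]
  have sim: "similar_mat_wit A B P Q" and ut: "upper_triangular B"
    and dg: "diag_mat B = \<mu> # \<mu> # xs @ ys @ zs" by auto
  note S = similar_mat_witD2[OF A sim]
  have m: "1 < m" "0 < m" using len by auto
  have dB: "B $$ (i, i) = (\<mu> # \<mu> # xs @ ys @ zs) ! i" if "i < m" for i
    using that S(5) dg[symmetric] by (simp add: diag_mat_def)
  have B: "B $$ (0, 0) = \<mu>" "B $$ (1, 1) = \<mu>" using dB m by auto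
  have low: "B $$ (i, j) = 0" if "j < i" "i < m" for i j
    using ut that S(5) by (auto simp: upper_triangular_def)
  have "A * P = P * B * (Q * P)" using S(3,4,5,6,7) A by (simp add: assoc_mult_mat[of _ m m _ m _ m])
  then have AP: "A * P = P * B" using S by simp
  have AP': "(\<Sum>l<m. A $$ (k, l) * P $$ (l, j)) = (\<Sum>l<m. P $$ (k, l) * B $$ (l, j))"
    if "k < m" "j < m" for k j
    using arg_cong[OF AP, of "\<lambda>X. X $$ (k, j)"] that A S
    by (simp add: scalar_prod_def atLeast0LessThan)
  show ?thesis
  proof (rule that)
    fix k assume k: "k < m"
    have "(\<Sum>l<m. P $$ (k, l) * B $$ (l, 0)) = (\<Sum>l\<in>{0}. P $$ (k, l) * B $$ (l, 0))"
      by (rule sum.mono_neutral_right) (use m low in auto)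
    then show "(\<Sum>l<m. A $$ (k, l) * P $$ (l, 0)) = \<mu> * P $$ (k, 0)"
      using AP' k m B by simp
    have "(\<Sum>l<m. P $$ (k, l) * B $$ (l, 1)) = (\<Sum>l\<in>{0, 1}. P $$ (k, l) * B $$ (l, 1))"
      by (rule sum.mono_neutral_right) (use m low in auto)
    then show "(\<Sum>l<m. A $$ (k, l) * P $$ (l, 1)) = \<mu> * P $$ (k, 1) + B $$ (0, 1) * P $$ (k, 0)"
      using AP' k m B by simp
  next
    fix \<alpha> \<beta> assume 0: "\<And>k. k < m \<Longrightarrow> \<alpha> * P $$ (k, 0) + \<beta> * P $$ (k, 1) = 0"
    have QP: "(\<Sum>k<m. Q $$ (i, k) * P $$ (k, j)) = (if i = j then 1 else 0)"
      if "i < m" "j < m" for i j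
      using arg_cong[OF S(2), of "\<lambda>X. X $$ (i, j)"] that S(5,6,7)
      by (simp add: scalar_prod_def atLeast0LessThan)
    have "\<alpha> * (if i = 0 then 1 else 0) + \<beta> * (if i = 1 then 1 else 0) = 0" if "i < m" for i
    proof -
      have "0 = (\<Sum>k<m. Q $$ (i, k) * (\<alpha> * P $$ (k, 0) + \<beta> * P $$ (k, 1)))"
        using 0 by simp
      also have "\<dots> = \<alpha> * (\<Sum>k<m. Q $$ (i, k) * P $$ (k, 0)) + \<beta> * (\<Sum>k<m. Q $$ (i, k) * P $$ (k, 1))"
        unfolding sum_distrib_left sum.distrib[symmetric] by (simp add: algebra_simps)
      finally show ?thesis using QP that m by simp
    qed
    from this[of 0] this[of 1] m show "\<alpha> = 0 \<and> \<beta> = 0" by simp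
  qed
qed

text \<open>
  The hypothesis \<open>sym\<close> says that \<open>A\<close> is self-adjoint for the inner product with weights
  \<open>w\<close>, so there are no proper generalized eigenvectors; \<open>simple\<close> says that the functional
  \<open>f\<close> is injective on every eigenspace, so every eigenspace is a line. Together they exclude
  multiple eigenvalues.
\<close>

lemma card_spectrum_symmetrizable:
  fixes A :: "complex mat" and w :: "nat \<Rightarrow> real" and f :: "nat \<Rightarrow> complex"
  assumes A: "A \<in> carrier_mat m m"
    and w: "\<And>k. k < m \<Longrightarrow> 0 < w k"
    and sym: "\<And>k l. k < m \<Longrightarrow> l < m \<Longrightarrow>
      of_real (w k) * A $$ (k, l) = cnj (of_real (w l) * A $$ (l, k))"
    and simple: "\<And>\<mu> x k. (\<And>k. k < m \<Longrightarrow> (\<Sum>l<m. A $$ (k, l) * x l) = \<mu> * x k) \<Longrightarrow>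
      (\<Sum>k<m. f k * x k) = 0 \<Longrightarrow> k < m \<Longrightarrow> x k = 0"
  shows "card (spectrum A) = m"
proof (rule ccontr)
  assume "card (spectrum A) \<noteq> m"
  then show False
  proof (rule generalized_eigenvector_of_double_root[OF A])
    fix \<mu> c x y
    assume x: "\<And>k. k < m \<Longrightarrow> (\<Sum>l<m. A $$ (k, l) * x l) = \<mu> * x k"
      and y: "\<And>k. k < m \<Longrightarrow> (\<Sum>l<m. A $$ (k, l) * y l) = \<mu> * y k + c * x k"
      and indep: "\<And>\<alpha> \<beta>. (\<And>k. k < m \<Longrightarrow> \<alpha> * x k + \<beta> * y k = 0) \<Longrightarrow> \<alpha> = 0 \<and> \<beta> = 0"
    define ip where "ip u v = (\<Sum>k<m. of_real (w k) * u k * cnj (v k))" for u v :: "nat \<Rightarrow> complex"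
    have adj: "ip (\<lambda>k. \<Sum>l<m. A $$ (k, l) * u l) v = ip u (\<lambda>k. \<Sum>l<m. A $$ (k, l) * v l)" for u v
    proof -
      have "ip (\<lambda>k. \<Sum>l<m. A $$ (k, l) * u l) v
          = (\<Sum>k<m. \<Sum>l<m. (of_real (w k) * A $$ (k, l)) * (u l * cnj (v k)))"
        unfolding ip_def by (simp add: sum_distrib_left sum_distrib_right mult_ac)
      also have "\<dots> = (\<Sum>k<m. \<Sum>l<m. cnj (of_real (w l) * A $$ (l, k)) * (u l * cnj (v k)))"
        by (intro sum.cong refl) (use sym in auto)
      also have "\<dots> = (\<Sum>l<m. \<Sum>k<m. cnj (of_real (w l) * A $$ (l, k)) * (u l * cnj (v k)))"
        by (rule sum.swap)
      also have "\<dots> = ip u (\<lambda>k. \<Sum>l<m. A $$ (k, l) * v l)"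
        unfolding ip_def by (simp add: sum_distrib_left sum_distrib_right mult_ac)
      finally show ?thesis .
    qed
    have pos: "ip x x \<noteq> 0"
    proof -
      obtain k where k: "k < m" "x k \<noteq> 0" using indep[of 1 0] by auto
      have "ip x x = of_real (\<Sum>k<m. w k * (cmod (x k))\<^sup>2)"
        unfolding ip_def by (simp add: mult.assoc complex_norm_square[symmetric] del: of_real_power)
      moreover have "0 < (\<Sum>k<m. w k * (cmod (x k))\<^sup>2)"
        by (rule sum_pos2[of _ k]) (use k w in \<open>auto simp: less_imp_le\<close>)
      ultimately show ?thesis by (metis of_real_eq_0_iff less_irrefl)
    qed
    have cong: "ip u v = ip u' v'"
      if "\<And>k. k < m \<Longrightarrow> u k = u' k" "\<And>k. k < m \<Longrightarrow> v k = v' k" for u u' v v'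
      unfolding ip_def by (intro sum.cong refl) (use that in auto)
    have L: "ip (\<lambda>k. \<Sum>l<m. A $$ (k, l) * x l) v = \<mu> * ip x v" for v
    proof -
      have "ip (\<lambda>k. \<Sum>l<m. A $$ (k, l) * x l) v = ip (\<lambda>k. \<mu> * x k) v"
        by (rule cong) (use x in auto)
      also have "\<dots> = \<mu> * ip x v"
        unfolding ip_def sum_distrib_left by (simp add: mult_ac)
      finally show ?thesis .
    qed
    have R: "ip v (\<lambda>k. \<Sum>l<m. A $$ (k, l) * x l) = cnj \<mu> * ip v x" for v
    proof -
      have "ip v (\<lambda>k. \<Sum>l<m. A $$ (k, l) * x l) = ip v (\<lambda>k. \<mu> * x k)"
        by (rule cong) (use x in auto)
      also have "\<dots> = cnj \<mu> * ip v x"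
        unfolding ip_def sum_distrib_left by (simp add: mult_ac)
      finally show ?thesis .
    qed
    have real: "cnj \<mu> = \<mu>" using adj[of x x] L[of x] R[of x] pos by simp
    have "ip (\<lambda>k. \<Sum>l<m. A $$ (k, l) * y l) x = ip (\<lambda>k. \<mu> * y k + c * x k) x"
      by (rule cong) (use y in auto)
    also have "\<dots> = \<mu> * ip y x + c * ip x x"
      unfolding ip_def sum_distrib_left sum.distrib[symmetric] by (simp add: algebra_simps)
    finally have "ip (\<lambda>k. \<Sum>l<m. A $$ (k, l) * y l) x = \<mu> * ip y x + c * ip x x" .
    with adj[of y x] R[of y] real pos have c: "c = 0" by simp
    define a where "a = (\<Sum>k<m. f k * x k)"
    define b where "b = (\<Sum>k<m. f k * y k)"
    \<comment> \<open>Both \<open>x\<close> and \<open>y\<close> are eigenvectors now; this combination of them is killed by \<open>f\<close>.\<close>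
    have "b * x k + (- a) * y k = 0" if "k < m" for k
    proof (rule simple[of "\<lambda>k. b * x k + (- a) * y k" \<mu>, OF _ _ that])
      fix k assume k: "k < m"
      have "(\<Sum>l<m. A $$ (k, l) * (b * x l + - a * y l))
        = b * (\<Sum>l<m. A $$ (k, l) * x l) + (- a) * (\<Sum>l<m. A $$ (k, l) * y l)"
        unfolding sum_distrib_left sum.distrib[symmetric] by (simp add: algebra_simps)
      then show "(\<Sum>l<m. A $$ (k, l) * (b * x l + - a * y l)) = \<mu> * (b * x k + - a * y k)"
        using x[OF k] y[OF k] c by (simp add: algebra_simps)
    next
      have "(\<Sum>k<m. f k * (b * x k + - a * y k)) = b * (\<Sum>k<m. f k * x k) + (- a) * (\<Sum>k<m. f k * y k)"
        unfolding sum_distrib_left sum.distrib[symmetric] by (simp add: algebra_simps)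
      then show "(\<Sum>k<m. f k * (b * x k + - a * y k)) = 0" by (simp add: a_def[symmetric] b_def[symmetric])
    qed
    from indep[OF this] have "a = 0" by simp
    then have "x k = 0" if "k < m" for k
      using simple[of x \<mu> k] x that by (simp add: a_def)
    with indep[of 1 0] show False by simp
  qed
qed

section \<open>The quotient matrix of alternating cells\<close>

text \<open>
  The vertices are grouped into \<open>m\<close> cells, numbered in the order of the construction, that are
  alternately isolated and dominating; \<open>size\<close> gives the numbers of vertices. The last cell is
  dominating because the graph is connected. The first cell has at least two vertices: the first two
  vertices of a threshold graph are always twins.
\<close>

locale alternating_cells =
  fixes m :: nat and size :: "nat \<Rightarrow> nat"
  assumes m_pos: "0 < m"
    and size_pos: "k < m \<Longrightarrow> 0 < size k"
    and size_0: "2 \<le> size 0"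
begin

text \<open>
  Cells alternate, so their types are determined by the parity of the distance from the end. The
  parity also declares the fictitious cell \<open>m\<close> isolated, which provides the boundary value
  \<open>nbsum_m\<close> of the recurrence \<open>nbsum_Suc\<close>.
\<close>

definition dominating :: "nat \<Rightarrow> bool" where
  "dominating k \<longleftrightarrow> odd (m - k)"

text \<open>
  Let \<open>y\<close> assign a number to every cell. Summed over all neighbours of a vertex of cell
  \<open>k\<close>, it yields \<open>nbsum y k\<close>, provided that a vertex in a dominating cell is counted as its
  own neighbour. This loop makes the recurrence \<open>nbsum_Suc\<close> uniform; it is compensated by the
  summand 1 in \<open>pivot\<close>.
\<close>

definition nbsum :: "(nat \<Rightarrow> 'a :: comm_ring_1) \<Rightarrow> nat \<Rightarrow> 'a" where
  "nbsum y k = (\<Sum>l<m. if dominating (max k l) then of_nat (size l) * y l else 0)"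

definition deg :: "nat \<Rightarrow> nat" where
  "deg k = (\<Sum>l<m. if dominating (max k l) then size l else 0) - (if dominating k then 1 else 0)"

text \<open>
  The matrix of the equitable partition into cells: row \<open>k\<close> lists how a vertex of cell
  \<open>k\<close> distributes its neighbours over the cells, relative to its degree.
\<close>

definition quotient :: "complex mat" where
  "quotient = mat m m (\<lambda>(k, l).
     ((if dominating (max k l) then of_nat (size l) else 0) - (if k = l \<and> dominating k then 1 else 0))
       / of_nat (deg k))"

text \<open>
  The eigenvector equation at a vertex of cell \<open>k\<close> reads \<open>pivot \<mu> k * y k = nbsum y k\<close>.
  Hence a vanishing pivot is the obstruction to solving the equations successively; it also
  characterises the eigenvalue \<open>\<mu>\<close> that belongs to differences of twins in cell \<open>k\<close>.
\<close>

definition pivot :: "complex \<Rightarrow> nat \<Rightarrow> complex" where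
  "pivot \<mu> k = of_nat (deg k) * \<mu> + (if dominating k then 1 else 0)"

lemma dominating_m [simp]: "\<not> dominating m"
  by (simp add: dominating_def)

lemma dominating_Suc: "k < m \<Longrightarrow> dominating (Suc k) \<longleftrightarrow> \<not> dominating k"
  by (auto simp: dominating_def Suc_diff_Suc[symmetric])

lemma dominating_last: "dominating (m - 1)"
  using m_pos by (simp add: dominating_def)

lemma nbsum_m: "nbsum y m = 0"
  by (simp add: nbsum_def max_def)

lemma nbsum_last: "nbsum y (m - 1) = (\<Sum>l<m. of_nat (size l) * y l)"
  unfolding nbsum_def by (intro sum.cong refl) (use dominating_last in \<open>auto simp: max_absorb1\<close>)

text \<open>
  Cells \<open>k - 1\<close> and \<open>k + 1\<close> have the same type, so their neighbourhoods (with loops) differ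
  exactly by cell \<open>k\<close>. For \<open>k = 0\<close> the truncated \<open>k - 1\<close> is 0, and the formula still
  holds because the neighbourhoods of cells 0 and 1 differ exactly by cell 0.
\<close>

lemma nbsum_Suc:
  assumes k: "k < m"
  shows "nbsum y (Suc k) =
    nbsum y (k - 1) + (if dominating k then - 1 else 1) * (of_nat (size k) * y k)"
proof -
  have same: "dominating (max (Suc k) l) = dominating (max (k - 1) l)" if "l \<noteq> k" for l
  proof (cases "l < k")
    case True
    then show ?thesis using k dominating_Suc[of k] dominating_Suc[of "k - 1"] by (simp add: max_absorb1)
  next
    case False
    then show ?thesis using that by (simp add: max_absorb2)
  qed
  have "nbsum y (Suc k) - nbsum y (k - 1) =
      (\<Sum>l<m. if l = k then (if dominating k then - 1 else 1) * (of_nat (size k) * y k) else 0)"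
    unfolding nbsum_def sum_subtractf[symmetric]
  proof (intro sum.cong refl)
    fix l
    show "(if dominating (max (Suc k) l) then of_nat (size l) * y l else 0)
        - (if dominating (max (k - 1) l) then of_nat (size l) * y l else 0)
      = (if l = k then (if dominating k then - 1 else 1) * (of_nat (size k) * y k) else 0)"
      using k same by (cases "l = k") (auto simp: dominating_Suc max_absorb1 max_absorb2)
  qed
  then show ?thesis using k by (simp add: algebra_simps)
qed

lemma deg_plus:
  assumes "k < m"
  shows "deg k + (if dominating k then 1 else 0)
    = (\<Sum>l<m. if dominating (max k l) then size l else 0)"
proof (cases "dominating k")
  case True
  have "size k \<le> (\<Sum>l<m. if dominating (max k l) then size l else 0)"
    using member_le_sum[of k "{..<m}" "\<lambda>l. if dominating (max k l) then size l else 0"] True assms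
    by simp
  then show ?thesis using size_pos[OF assms] by (simp add: deg_def)
qed (simp add: deg_def)

lemma size_le_deg:
  assumes "k < m" "l < m" "k \<noteq> l" "dominating (max k l)"
  shows "size l \<le> deg k"
proof -
  have "(\<Sum>i\<in>{k, l}. if dominating (max k i) then size i else 0)
      \<le> (\<Sum>i<m. if dominating (max k i) then size i else 0)"
    by (rule sum_mono2) (use assms in auto)
  then show ?thesis using deg_plus[OF assms(1)] assms size_pos[OF assms(1)] by (auto split: if_splits)
qed

lemma deg_pos:
  assumes k: "k < m"
  shows "0 < deg k"
proof (cases "k = m - 1")
  case False
  then have "size (m - 1) \<le> deg k"
    using k dominating_last by (intro size_le_deg) (auto simp: max_def)
  then show ?thesis using size_pos[of "m - 1"] m_pos by simp
next
  case last: True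
  show ?thesis
  proof (cases "k = 0")
    case True
    then have "m = 1" using last m_pos by simp
    then show ?thesis using deg_plus[OF k] size_0 True dominating_last by simp
  next
    case False
    then have "size 0 \<le> deg k"
      using k last dominating_last by (intro size_le_deg) (auto simp: max_def)
    then show ?thesis using size_0 by simp
  qed
qed

lemma deg_less:
  assumes jk: "j < k" "k < m" and "dominating j" "dominating k"
  shows "deg j < deg k"
proof -
  have "(\<Sum>l<m. if dominating (max j l) then size l else 0)
      < (\<Sum>l<m. if dominating (max k l) then size l else 0)"
  proof (rule sum_strict_mono_ex1)
    have "\<not> dominating (Suc j)" using assms dominating_Suc by simp
    then have "dominating (max j (Suc j)) = False" by (simp add: max_def)
    moreover have "dominating (max k (Suc j))" using assms by (simp add: max_absorb1)
    ultimately show "\<exists>l\<in>{..<m}. (if dominating (max j l) then size l else 0)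
        < (if dominating (max k l) then size l else 0)"
      using assms size_pos[of "Suc j"] by (intro bexI[of _ "Suc j"]) auto
  qed (use assms in \<open>auto simp: max_def\<close>)
  then show ?thesis using deg_plus[of j] deg_plus[of k] assms by simp
qed

lemma deg_0_le:
  assumes k: "k < m" "dominating k"
  shows "deg 0 \<le> deg k"
proof (cases "dominating 0")
  case True
  then show ?thesis using deg_less[of 0 k] k by (cases "k = 0") auto
next
  case False
  have "(\<Sum>l<m. if dominating (max 0 l) then size l else 0)
      < (\<Sum>l<m. if dominating (max k l) then size l else 0)"
    by (rule sum_strict_mono_ex1)
       (use k False size_0 in \<open>auto simp: max_def intro!: bexI[of _ 0]\<close>)
  then show ?thesis using deg_plus[of 0] deg_plus[of k] False k m_pos by simp
qed

lemma quotient_eigen_iff: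
  assumes k: "k < m"
  shows "(\<Sum>l<m. quotient $$ (k, l) * y l) = \<mu> * y k \<longleftrightarrow> pivot \<mu> k * y k = nbsum y k"
proof -
  have d: "of_nat (deg k) \<noteq> (0 :: complex)" using deg_pos[OF k] by simp
  have "(\<Sum>l<m. quotient $$ (k, l) * y l) * of_nat (deg k)
      = (\<Sum>l<m. (if dominating (max k l) then of_nat (size l) * y l else 0)
          - (if l = k then (if dominating k then y k else 0) else 0))"
    unfolding sum_distrib_right
    by (intro sum.cong refl) (use k d in \<open>auto simp: quotient_def field_simps\<close>)
  also have "\<dots> = nbsum y k - (if dominating k then y k else 0)"
    unfolding sum_subtractf nbsum_def using k by simp
  finally have scaled: "(\<Sum>l<m. quotient $$ (k, l) * y l) * of_nat (deg k)
    = nbsum y k - (if dominating k then y k else 0)" .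
  have "(\<Sum>l<m. quotient $$ (k, l) * y l) = \<mu> * y k \<longleftrightarrow>
      (\<Sum>l<m. quotient $$ (k, l) * y l) * of_nat (deg k) = \<mu> * y k * of_nat (deg k)"
    using deg_pos[OF k] by simp
  then show ?thesis unfolding scaled by (auto simp: pivot_def algebra_simps)
qed

text \<open>
  Let \<open>\<mu> = - 1 / deg k\<close> be the value for which the pivot of the dominating cell \<open>k\<close> vanishes.
  Degrees of dominating cells increase, so before \<open>k\<close> the pivots of dominating cells are
  positive, while those of isolated cells are negative. The recurrence for \<open>u = nbsum y\<close>
  therefore takes the form \<open>u (j + 1) = u (j - 1) - \<kappa> * u j\<close> with \<open>\<kappa> > 0\<close>, which preserves alternation of
  signs. It starts with \<open>u 1 = u 0 - \<kappa> * u 0\<close>, where \<open>\<kappa> > 1\<close> since the first cell has at least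
  two vertices and the absolute value of its pivot is at most 1.
\<close>

lemma nbsum_alternates:
  assumes k: "k < m" "dominating k" and \<mu>: "pivot \<mu> k = 0"
    and eigen: "\<And>j. j < m \<Longrightarrow> pivot \<mu> j * y j = nbsum y j"
    and j: "j < k"
  shows "\<exists>\<rho>>0. nbsum y (Suc j) = - of_real \<rho> * nbsum y j"
proof -
  have \<mu>': "\<mu> = - 1 / of_nat (deg k)"
    using \<mu> k deg_pos[of k] by (auto simp: pivot_def field_simps add_eq_0_iff)
  have step: "\<exists>\<kappa>>0. (i = 0 \<longrightarrow> 1 < \<kappa>) \<and>
      (if dominating i then - 1 else 1) * (of_nat (size i) * y i) = - of_real \<kappa> * nbsum y i"
    if i: "i < k" for i
  proof -
    define g where "g = (if dominating i then 1 else 0) - real (deg i) / real (deg k)"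
    have im: "i < m" using i k by simp
    have p: "pivot \<mu> i = of_real g" by (simp add: pivot_def \<mu>' g_def)
    define s where "s = (if dominating i then - 1 else 1 :: real)"
    have sg: "s * g < 0 \<and> (i = 0 \<longrightarrow> \<bar>g\<bar> \<le> 1)"
      using deg_less[of i k] deg_0_le[of k] deg_pos[OF im] deg_pos[of k] i k
      by (auto simp: g_def s_def field_simps)
    then have g0: "g \<noteq> 0" by auto
    define \<kappa> where "\<kappa> = - s * size i / g"
    have "\<kappa> = size i / \<bar>g\<bar>"
      using sg by (auto simp: \<kappa>_def s_def split: if_splits)
    then have "0 < \<kappa>" "i = 0 \<longrightarrow> 1 < \<kappa>"
      using size_pos[OF im] size_0 g0 sg by (auto simp: less_divide_eq)
    moreover have "y i = nbsum y i / of_real g"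
      using eigen[OF im] g0 by (simp add: p field_simps)
    then have "(if dominating i then - 1 else 1) * (of_nat (size i) * y i) = - of_real \<kappa> * nbsum y i"
      by (simp add: \<kappa>_def s_def)
    ultimately show ?thesis by blast
  qed
  show ?thesis
    using j
  proof (induction j)
    case 0
    then obtain \<kappa> where \<kappa>: "1 < \<kappa>"
      "(if dominating 0 then - 1 else 1) * (of_nat (size 0) * y 0) = - of_real \<kappa> * nbsum y 0"
      using step by blast
    have "nbsum y (Suc 0) = nbsum y 0 + - of_real \<kappa> * nbsum y 0"
      using nbsum_Suc[of 0 y] m_pos \<kappa>(2) by simp
    then show ?case
      using \<kappa>(1) by (intro exI[of _ "\<kappa> - 1"]) (simp add: algebra_simps)
  next
    case (Suc j)
    then obtain \<rho> where \<rho>: "0 < \<rho>" "nbsum y (Suc j) = - of_real \<rho> * nbsum y j" by auto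
    obtain \<kappa> where \<kappa>: "0 < \<kappa>"
      "(if dominating (Suc j) then - 1 else 1) * (of_nat (size (Suc j)) * y (Suc j))
        = - of_real \<kappa> * nbsum y (Suc j)"
      using step[OF Suc.prems] by blast
    have "nbsum y (Suc (Suc j)) = nbsum y j + - of_real \<kappa> * nbsum y (Suc j)"
      using nbsum_Suc[of "Suc j" y] Suc.prems k \<kappa>(2) by simp
    also have "nbsum y j = - of_real (1 / \<rho>) * nbsum y (Suc j)"
      using \<rho> by simp
    finally have "nbsum y (Suc (Suc j)) = - of_real (1 / \<rho> + \<kappa>) * nbsum y (Suc j)"
      by (simp only: of_real_add) (simp add: algebra_simps)
    then show ?case
      using \<rho>(1) \<kappa>(1) by (intro exI[of _ "1 / \<rho> + \<kappa>"]) (simp add: add_pos_pos)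
  qed
qed

text \<open>
  An eigenvector on cells with total \<open>\<Sum> size l * y l = nbsum y (m - 1) = 0\<close> vanishes. Otherwise
  consider the last cell \<open>k\<close> where it does not vanish. Running the recurrence \<open>nbsum_Suc\<close>
  backwards from the end, all values of \<open>nbsum\<close> from \<open>k\<close> on are 0, so the pivot of \<open>k\<close>
  vanishes, but \<open>nbsum y (k - 1)\<close> is not 0. If \<open>k\<close> is dominating, this contradicts
  \<open>nbsum_alternates\<close>. If \<open>k\<close> is isolated, then \<open>\<mu> = 0\<close>, and the equations for the two
  preceding cells are contradictory.
\<close>

lemma eigenvector_eq_0_if_total_0:
  assumes eigen: "\<And>j. j < m \<Longrightarrow> pivot \<mu> j * y j = nbsum y j"
    and total: "nbsum y (m - 1) = 0" and l: "l < m"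
  shows "y l = 0"
proof (rule ccontr)
  assume "y l \<noteq> 0"
  define k where "k = Max {k. k < m \<and> y k \<noteq> 0}"
  have "k \<in> {k. k < m \<and> y k \<noteq> 0}"
    unfolding k_def by (rule Max_in) (use l \<open>y l \<noteq> 0\<close> in auto)
  then have k: "k < m" "y k \<noteq> 0" by auto
  have beyond: "y j = 0" if "k < j" "j < m" for j
  proof (rule ccontr)
    assume "y j \<noteq> 0"
    then have "j \<le> k" unfolding k_def using that by (intro Max_ge) auto
    with that show False by simp
  qed
  have "k \<le> m - 1" using k by simp
  then have z: "nbsum y k = 0 \<and> nbsum y (Suc k) = 0"
  proof (induction rule: inc_induct)
    case base
    show ?case using total nbsum_m m_pos by simp
  next
    case (step j)
    then show ?case using nbsum_Suc[of "Suc j" y] beyond[of "Suc j"] by simp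
  qed
  have piv: "pivot \<mu> k = 0" using eigen[OF k(1)] z k by simp
  have prev: "nbsum y (k - 1) \<noteq> 0"
    using nbsum_Suc[OF k(1), of y] z k size_pos[OF k(1)] by (auto split: if_splits)
  with z have k0: "0 < k" by (cases k) auto
  show False
  proof (cases "dominating k")
    case True
    then obtain \<rho> :: real where "0 < \<rho>" "nbsum y k = - of_real \<rho> * nbsum y (k - 1)"
      using nbsum_alternates[OF k(1) True piv eigen, of "k - 1"] k0 by auto
    then show False using z prev by simp
  next
    case False
    then have \<mu>: "\<mu> = 0" using piv deg_pos[OF k(1)] by (simp add: pivot_def)
    have dom: "dominating (k - 1)" using False dominating_Suc[of "k - 1"] k k0 by simp
    then have "y (k - 1) = nbsum y (k - 1)"
      using eigen[of "k - 1"] k \<mu> by (simp add: pivot_def)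
    then have eq: "nbsum y (k - 1 - 1) = of_nat (size (k - 1)) * nbsum y (k - 1)"
      using nbsum_Suc[of "k - 1" y] z k k0 dom by simp
    show False
    proof (cases "k = 1")
      case True
      then have "(of_nat (size 0) - 1) * nbsum y 0 = 0" using eq by (simp add: algebra_simps)
      moreover have "(of_nat (size 0) :: complex) \<noteq> 1" using size_0 by simp
      ultimately show False using prev True by simp
    next
      case False
      then have "\<not> dominating (k - 1 - 1)"
        using dom dominating_Suc[of "k - 1 - 1"] k k0 by (simp add: Suc_diff_Suc)
      then have "nbsum y (k - 1 - 1) = 0" using eigen[of "k - 1 - 1"] k \<mu> by (simp add: pivot_def)
      moreover have "size (k - 1) \<noteq> 0" using size_pos[of "k - 1"] k by simp
      ultimately show False using eq prev by simp
    qed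
  qed
qed

text \<open>
  The weights \<open>size k * deg k\<close> symmetrize the quotient matrix, because both sides then count the
  edges between two cells.
\<close>

lemma card_spectrum_quotient: "card (spectrum quotient) = m"
proof (rule card_spectrum_symmetrizable)
  show "quotient \<in> carrier_mat m m" by (simp add: quotient_def)
  show "0 < real (size k * deg k)" if "k < m" for k
    using that size_pos deg_pos by simp
  show "of_real (real (size k * deg k)) * quotient $$ (k, l)
      = cnj (of_real (real (size l * deg l)) * quotient $$ (l, k))" if "k < m" "l < m" for k l
    using that deg_pos[of k] deg_pos[of l] by (auto simp: quotient_def max.commute)
  show "x k = 0" if "\<And>k. k < m \<Longrightarrow> (\<Sum>l<m. quotient $$ (k, l) * x l) = \<mu> * x k"
      "(\<Sum>k<m. of_nat (size k) * x k) = 0" "k < m" for \<mu> x k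
  proof (rule eigenvector_eq_0_if_total_0)
    show "pivot \<mu> j * x j = nbsum x j" if "j < m" for j
      using that \<open>\<And>k. k < m \<Longrightarrow> (\<Sum>l<m. quotient $$ (k, l) * x l) = \<mu> * x k\<close> quotient_eigen_iff by blast
    show "nbsum x (m - 1) = 0" unfolding nbsum_last by fact
  qed fact
qed

lemma spectrum_quotient_iff:
  "\<mu> \<in> spectrum quotient \<longleftrightarrow>
    (\<exists>y. (\<exists>k<m. y k \<noteq> 0) \<and> (\<forall>k<m. pivot \<mu> k * y k = nbsum y k))"
proof -
  have "quotient \<in> carrier_mat m m" by (simp add: quotient_def)
  from eigenvalue_iff_function[OF this] show ?thesis
    by (simp add: spectrum_def quotient_eigen_iff)
qed

lemma pivot_last_not_eigenvalue:
  assumes "pivot \<mu> (m - 1) = 0"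
  shows "\<mu> \<notin> spectrum quotient"
proof
  assume "\<mu> \<in> spectrum quotient"
  then obtain y where y: "\<exists>k<m. y k \<noteq> 0" "\<And>k. k < m \<Longrightarrow> pivot \<mu> k * y k = nbsum y k"
    by (auto simp: spectrum_quotient_iff)
  have "nbsum y (m - 1) = 0" using y(2)[of "m - 1"] assms m_pos by simp
  with y eigenvector_eq_0_if_total_0[of \<mu> y] show False by auto
qed

lemma zero_not_eigenvalue: "0 \<notin> spectrum quotient"
proof
  assume "0 \<in> spectrum quotient"
  then obtain y where y: "\<exists>k<m. y k \<noteq> 0" "\<And>k. k < m \<Longrightarrow> pivot 0 k * y k = nbsum y k"
    by (auto simp: spectrum_quotient_iff)
  have top: "nbsum y (m - 1 - 1) = of_nat (size (m - 1)) * y (m - 1)"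
    using nbsum_Suc[of "m - 1" y] nbsum_m[of y] dominating_last m_pos by simp
  have last: "y (m - 1) = nbsum y (m - 1)"
    using y(2)[of "m - 1"] dominating_last m_pos by (simp add: pivot_def)
  have "y (m - 1) = 0"
  proof (cases "m = 1")
    case True
    then have "(of_nat (size 0) - 1) * y 0 = 0" using top last by (simp add: algebra_simps)
    moreover have "(of_nat (size 0) :: complex) \<noteq> 1" using size_0 by simp
    ultimately show ?thesis using True by simp
  next
    case False
    then have "\<not> dominating (m - 1 - 1)"
      using dominating_last dominating_Suc[of "m - 1 - 1"] m_pos by (simp add: Suc_diff_Suc)
    then have "nbsum y (m - 1 - 1) = 0" using y(2)[of "m - 1 - 1"] m_pos by (simp add: pivot_def)
    then show ?thesis using top size_pos[of "m - 1"] m_pos by simp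
  qed
  then show False using eigenvector_eq_0_if_total_0[of 0 y] y last by auto
qed

text \<open>
  For this value of \<open>\<mu>\<close> the equations in cells 1 and 2 reduce to \<open>y 1 = - d * y 2\<close> and
  \<open>y 2 = - d * y 1\<close>, where \<open>d\<close> is the degree of cell 0, which exceeds 1. There is no analogue
  for many cells: for cells of sizes 3, 7, 1, 1, 1 the vertices of the first cell have degree 4, and \<open>- 1 / 4\<close> is an
  eigenvalue of the quotient matrix.
\<close>

lemma pivot_0_not_eigenvalue_if_3_cells:
  assumes m: "m = 3" and piv: "pivot \<mu> 0 = 0"
  shows "\<mu> \<notin> spectrum quotient"
proof
  assume "\<mu> \<in> spectrum quotient"
  then obtain y where y: "\<exists>k<m. y k \<noteq> 0" "\<And>k. k < m \<Longrightarrow> pivot \<mu> k * y k = nbsum y k"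
    by (auto simp: spectrum_quotient_iff)
  have dom: "dominating 0" "\<not> dominating 1" "dominating 2"
    unfolding dominating_def using m by simp_all
  have dom3: "dominating (Suc (Suc 0))" using dom(3) by (simp add: numeral_2_eq_2)
  have lt: "0 < m" "1 < m" "2 < m" and last: "m - 1 = 2" using m by auto
  have le3: "{..<m} = {0, 1, 2}" using m by auto
  have deg: "deg 0 + 1 = size 0 + size 2" "deg 1 = size 2" "deg 2 + 1 = size 0 + size 1 + size 2"
    using deg_plus[of 0] deg_plus[of 1] deg_plus[of 2] dom dom3 lt by (auto simp: le3)
  have nb: "nbsum y 0 = of_nat (size 0) * y 0 + of_nat (size 2) * y 2"
    "nbsum y 1 = of_nat (size 2) * y 2"
    "nbsum y 2 = of_nat (size 0) * y 0 + of_nat (size 1) * y 1 + of_nat (size 2) * y 2"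
    using dom dom3 by (auto simp: nbsum_def le3)
  have pos: "size 0 \<ge> 2" "size 1 > 0" "size 2 > 0" using size_0 size_pos lt by auto
  define d where "d = (of_nat (deg 0) :: complex)"
  have d0: "d \<noteq> 0" using deg pos by (simp add: d_def)
  have \<mu>: "\<mu> = - 1 / d" using piv dom d0 by (simp add: pivot_def d_def field_simps add_eq_0_iff)
  have n0: "nbsum y 0 = 0" using y(2)[of 0] piv lt by simp
  have "of_nat (deg 1) * \<mu> * y 1 = of_nat (size 2) * y 2"
    using y(2)[of 1] dom lt nb by (simp add: pivot_def)
  then have "of_nat (size 2) * (y 1 + d * y 2) = 0"
    using deg(2) d0 by (simp add: \<mu> field_simps add_eq_0_iff)
  then have y1: "y 1 = - d * y 2" using pos by (simp add: add_eq_0_iff2)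
  have "deg 2 = deg 0 + size 1" using deg by simp
  then have "pivot \<mu> 2 = - of_nat (size 1) / d"
    using dom d0 by (simp add: pivot_def \<mu> d_def[symmetric] field_simps)
  moreover have "pivot \<mu> 2 * y 2 = of_nat (size 1) * y 1"
    using y(2)[of 2] lt nb n0 by (simp add: algebra_simps)
  ultimately have "- of_nat (size 1) / d * y 2 = of_nat (size 1) * y 1" by simp
  then have "of_nat (size 1) * (y 2 + d * y 1) = 0"
    using d0 by (simp add: field_simps add_eq_0_iff)
  then have "y 2 = - d * y 1" using pos by (simp add: add_eq_0_iff2)
  then have "y 2 * (d - 1) * (d + 1) = 0" using y1 by (simp add: algebra_simps)
  moreover have "d - 1 \<noteq> 0" "d + 1 \<noteq> 0"
  proof -
    have "deg 0 \<noteq> 1" using deg pos by simp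
    then show "d - 1 \<noteq> 0" by (simp add: d_def)
    have "of_nat (Suc (deg 0)) \<noteq> (0 :: complex)" by (rule of_nat_neq_0)
    then show "d + 1 \<noteq> 0" by (simp add: d_def add.commute)
  qed
  ultimately have "y 2 = 0" by simp
  then have "nbsum y (m - 1) = 0" unfolding last using y1 nb n0 by simp
  then show False using eigenvector_eq_0_if_total_0[of \<mu> y] y by auto
qed

end

section \<open>From cells to vertices\<close>

locale threshold_cells = alternating_cells +
  fixes n :: nat and cell :: "nat \<Rightarrow> nat"
  assumes cell_less: "i < n \<Longrightarrow> cell i < m"
    and size_eq: "k < m \<Longrightarrow> size k = card {i. i < n \<and> cell i = k}"
begin

definition vertex_matrix :: "complex mat" where
  "vertex_matrix = mat n n (\<lambda>(i, j).
     if i \<noteq> j \<and> dominating (max (cell i) (cell j)) then 1 / of_nat (deg (cell i)) else 0)"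

lemma sum_over_cells:
  "(\<Sum>j<n. F (cell j)) = (\<Sum>k<m. of_nat (size k) * (F k :: 'a :: comm_ring_1))"
proof -
  have "(\<Sum>j<n. F (cell j)) = (\<Sum>k<m. \<Sum>j\<in>{j \<in> {..<n}. cell j = k}. F (cell j))"
    by (rule sum.group[symmetric]) (use cell_less in auto)
  also have "\<dots> = (\<Sum>k<m. of_nat (size k) * F k)"
    by (intro sum.cong refl) (simp add: size_eq)
  finally show ?thesis .
qed

lemma cell_surj:
  assumes "k < m"
  obtains i where "i < n" "cell i = k"
proof -
  have "{i. i < n \<and> cell i = k} \<noteq> {}" using size_pos[OF assms] size_eq[OF assms] by force
  with that show ?thesis by auto
qed

lemma card_neighbours:
  assumes i: "i < n"
  shows "card {j. j < n \<and> i \<noteq> j \<and> dominating (max (cell i) (cell j))} = deg (cell i)"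
proof -
  let ?N = "{j. j < n \<and> dominating (max (cell i) (cell j))}"
  have "int (card ?N) = (\<Sum>j<n. if dominating (max (cell i) (cell j)) then 1 else 0)"
    by (simp add: sum.If_cases Int_def)
  also have "\<dots> = (\<Sum>k<m. int (if dominating (max (cell i) k) then size k else 0))"
    unfolding sum_over_cells[of "\<lambda>k. if dominating (max (cell i) k) then 1 else 0"]
    by (intro sum.cong refl) auto
  also have "\<dots> = int (deg (cell i) + (if dominating (cell i) then 1 else 0))"
    unfolding deg_plus[OF cell_less[OF i]] by simp
  finally have N: "card ?N = deg (cell i) + (if dominating (cell i) then 1 else 0)" by linarith
  have "{j. j < n \<and> i \<noteq> j \<and> dominating (max (cell i) (cell j))} = ?N - {i}" by auto
  then show ?thesis using N i by (simp add: card_Diff_singleton_if)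
qed

text \<open>
  Subtracting two of these equations shows that an eigenvector takes the same value on twins unless
  the pivot of their cell vanishes.
\<close>

lemma vertex_matrix_eigen_iff:
  assumes i: "i < n"
  shows "(\<Sum>j<n. vertex_matrix $$ (i, j) * x j) = \<mu> * x i \<longleftrightarrow>
    pivot \<mu> (cell i) * x i = (\<Sum>j<n. if dominating (max (cell i) (cell j)) then x j else 0)"
proof -
  have d: "of_nat (deg (cell i)) \<noteq> (0 :: complex)" using deg_pos[OF cell_less[OF i]] by simp
  have "(\<Sum>j<n. vertex_matrix $$ (i, j) * x j) * of_nat (deg (cell i))
      = (\<Sum>j<n. (if dominating (max (cell i) (cell j)) then x j else 0)
          - (if j = i then (if dominating (cell i) then x i else 0) else 0))"
    unfolding sum_distrib_right
    by (intro sum.cong refl) (use i d in \<open>auto simp: vertex_matrix_def\<close>)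
  also have "\<dots> = (\<Sum>j<n. if dominating (max (cell i) (cell j)) then x j else 0)
      - (if dominating (cell i) then x i else 0)"
    unfolding sum_subtractf using i by simp
  finally have scaled: "(\<Sum>j<n. vertex_matrix $$ (i, j) * x j) * of_nat (deg (cell i))
    = (\<Sum>j<n. if dominating (max (cell i) (cell j)) then x j else 0)
      - (if dominating (cell i) then x i else 0)" .
  have "(\<Sum>j<n. vertex_matrix $$ (i, j) * x j) = \<mu> * x i \<longleftrightarrow>
      (\<Sum>j<n. vertex_matrix $$ (i, j) * x j) * of_nat (deg (cell i))
        = \<mu> * x i * of_nat (deg (cell i))"
    using d by simp
  then show ?thesis unfolding scaled by (auto simp: pivot_def algebra_simps)
qed

lemma spectrum_vertex_matrix_iff:
  "\<mu> \<in> spectrum vertex_matrix \<longleftrightarrow> (\<exists>x. (\<exists>i<n. x i \<noteq> 0) \<and>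
    (\<forall>i<n. pivot \<mu> (cell i) * x i
      = (\<Sum>j<n. if dominating (max (cell i) (cell j)) then x j else 0)))"
proof -
  have "vertex_matrix \<in> carrier_mat n n" by (simp add: vertex_matrix_def)
  from eigenvalue_iff_function[OF this] show ?thesis
    by (simp add: spectrum_def vertex_matrix_eigen_iff)
qed

lemma sum_cell_function:
  "(\<Sum>j<n. if dominating (max k (cell j)) then y (cell j) else 0) = nbsum y k"
  unfolding sum_over_cells[of "\<lambda>l. if dominating (max k l) then y l else 0"] nbsum_def
  by (intro sum.cong refl) auto

lemma spectrum_quotient_subset: "spectrum quotient \<subseteq> spectrum vertex_matrix"
proof
  fix \<mu> assume "\<mu> \<in> spectrum quotient"
  then obtain y k where y: "k < m" "y k \<noteq> 0" "\<And>k. k < m \<Longrightarrow> pivot \<mu> k * y k = nbsum y k"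
    unfolding spectrum_quotient_iff by blast
  obtain i where "i < n" "cell i = k" using cell_surj[OF y(1)] .
  then show "\<mu> \<in> spectrum vertex_matrix"
    unfolding spectrum_vertex_matrix_iff using y cell_less
    by (intro exI[of _ "\<lambda>i. y (cell i)"]) (auto simp: sum_cell_function)
qed

text \<open>
  The eigenvector is the difference of the indicators of two vertices in cell \<open>k\<close>: every other
  vertex is adjacent to both or to neither.
\<close>

lemma twin_eigenvalue:
  assumes k: "k < m" "2 \<le> size k" and piv: "pivot \<mu> k = 0"
  shows "\<mu> \<in> spectrum vertex_matrix"
proof -
  obtain i j where ij: "i < n" "j < n" "cell i = k" "cell j = k" "i \<noteq> j"
    using k size_eq[OF k(1)] card_le_Suc0_iff_eq[of "{i. i < n \<and> cell i = k}"] by auto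
  define x :: "nat \<Rightarrow> complex" where "x l = (if l = i then 1 else 0) - (if l = j then 1 else 0)" for l
  have "(\<Sum>l<n. if dominating (max p (cell l)) then x l else 0) = 0" for p
  proof -
    have "(\<Sum>l<n. if dominating (max p (cell l)) then x l else 0)
      = (\<Sum>l<n. (if l = i then (if dominating (max p k) then 1 else 0) else 0)
              - (if l = j then (if dominating (max p k) then 1 else 0) else 0))"
      by (intro sum.cong refl) (use ij in \<open>auto simp: x_def\<close>)
    then show ?thesis using ij by (simp add: sum_subtractf)
  qed
  moreover have "pivot \<mu> (cell l) * x l = 0" for l
    using ij piv by (auto simp: x_def)
  moreover have "x i \<noteq> 0" using ij by (simp add: x_def)
  ultimately show ?thesis
    unfolding spectrum_vertex_matrix_iff using ij(1) by (intro exI[of _ x]) auto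
qed

text \<open>
  If no cell with twins has vanishing pivot, an eigenvector is constant on cells, so its
  values on the cells form an eigenvector of the quotient matrix.
\<close>

lemma spectrum_vertex_matrix:
  "spectrum vertex_matrix = spectrum quotient \<union> {\<mu>. \<exists>k<m. 2 \<le> size k \<and> pivot \<mu> k = 0}"
proof (intro equalityI subsetI)
  fix \<mu> assume "\<mu> \<in> spectrum vertex_matrix"
  then obtain x where x: "\<exists>i<n. x i \<noteq> 0"
    "\<And>i. i < n \<Longrightarrow> pivot \<mu> (cell i) * x i
      = (\<Sum>j<n. if dominating (max (cell i) (cell j)) then x j else 0)"
    unfolding spectrum_vertex_matrix_iff by blast
  show "\<mu> \<in> spectrum quotient \<union> {\<mu>. \<exists>k<m. 2 \<le> size k \<and> pivot \<mu> k = 0}"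
  proof (cases "\<exists>k<m. 2 \<le> size k \<and> pivot \<mu> k = 0")
    case False
    have twins: "x i = x j" if ij: "i < n" "j < n" "cell i = cell j" for i j
    proof (cases "i = j")
      case False
      then have "2 \<le> card {l. l < n \<and> cell l = cell i}"
        using ij card_mono[of "{l. l < n \<and> cell l = cell i}" "{i, j}"] by auto
      then have "pivot \<mu> (cell i) \<noteq> 0"
        using \<open>\<not> (\<exists>k<m. _ k)\<close> size_eq cell_less ij(1) by metis
      moreover have "pivot \<mu> (cell i) * x i = pivot \<mu> (cell i) * x j"
        using x(2)[OF ij(1)] x(2)[OF ij(2)] ij(3) by simp
      ultimately show ?thesis by simp
    qed simp
    define y where "y k = x (SOME i. i < n \<and> cell i = k)" for k
    have xy: "x i = y (cell i)" if "i < n" for i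
    proof -
      have "(SOME j. j < n \<and> cell j = cell i) < n \<and> cell (SOME j. j < n \<and> cell j = cell i) = cell i"
        by (rule someI[of "\<lambda>j. j < n \<and> cell j = cell i" i]) (use that in simp)
      then show ?thesis unfolding y_def using that by (intro twins) simp_all
    qed
    have "pivot \<mu> k * y k = nbsum y k" if k: "k < m" for k
    proof -
      obtain i where i: "i < n" "cell i = k" using cell_surj[OF k] .
      have "(\<Sum>j<n. if dominating (max k (cell j)) then x j else 0)
          = (\<Sum>j<n. if dominating (max k (cell j)) then y (cell j) else 0)"
        by (intro sum.cong refl) (simp add: xy)
      then show ?thesis using x(2)[OF i(1)] i by (simp add: xy sum_cell_function)
    qed
    moreover have "\<exists>k<m. y k \<noteq> 0" using x(1) xy cell_less by metis
    ultimately show ?thesis unfolding Un_iff spectrum_quotient_iff by blast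
  qed simp
qed (use spectrum_quotient_subset twin_eigenvalue in auto)

lemma finite_spectrum_quotient: "finite (spectrum quotient)"
  by (rule card_finite_spectrum[of _ m]) (simp add: quotient_def)

lemma finite_spectrum_vertex_matrix: "finite (spectrum vertex_matrix)"
  by (rule card_finite_spectrum[of _ n]) (simp add: vertex_matrix_def)

lemma pivot_eq_0_iff:
  assumes "k < m"
  shows "pivot \<mu> k = 0 \<longleftrightarrow> \<mu> = (if dominating k then - 1 / of_nat (deg k) else 0)"
  using deg_pos[OF assms] by (auto simp: pivot_def field_simps add_eq_0_iff)

lemma card_spectrum_if_disjoint:
  assumes "spectrum vertex_matrix = spectrum quotient \<union> T" "spectrum quotient \<inter> T = {}" "finite T"
  shows "card (spectrum vertex_matrix) = m + card T"
  unfolding assms(1) card_Un_disjoint[OF finite_spectrum_quotient assms(3,2)] card_spectrum_quotient ..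

text \<open>
  In the following counts, the \<open>m\<close> eigenvalues of the quotient matrix are supplemented by those
  of the twins: 0 if some isolated cell has twins and \<open>- 1 / deg k\<close> for every dominating cell
  \<open>k\<close> with twins. The first cell always has twins.
\<close>

lemma card_spectrum_1_cell:
  assumes "m = 1"
  shows "card (spectrum vertex_matrix) = 2"
proof -
  have "dominating 0" using dominating_last assms by simp
  then have "spectrum vertex_matrix = insert (- 1 / of_nat (deg 0)) (spectrum quotient)"
    unfolding spectrum_vertex_matrix using pivot_eq_0_iff[of 0] size_0 m_pos assms
    by (auto simp: less_Suc_eq)
  moreover have "- 1 / of_nat (deg 0) \<notin> spectrum quotient"
    using pivot_last_not_eigenvalue pivot_eq_0_iff[of 0] \<open>dominating 0\<close> assms m_pos by simp
  ultimately show ?thesis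
    using finite_spectrum_quotient card_spectrum_quotient assms by simp
qed

lemma card_spectrum_2_cells:
  assumes m: "m = 2"
  shows "card (spectrum vertex_matrix) = (if size 1 = 1 then 3 else 4)"
proof -
  have lt: "0 < m" "1 < m" and all: "k < m \<longleftrightarrow> k = 0 \<or> k = 1" for k using m by auto
  have dom: "\<not> dominating 0" "dominating 1" unfolding dominating_def using m by simp_all
  define T where "T = (if size 1 = 1 then {} else {- 1 / of_nat (deg 1) :: complex})"
  \<comment> \<open>\<open>T\<close> is the contribution of cell 1; cell 0 contributes the eigenvalue 0.\<close>
  have "spectrum vertex_matrix = spectrum quotient \<union> insert 0 T"
    unfolding spectrum_vertex_matrix all
    using pivot_eq_0_iff lt dom size_0 size_pos[OF lt(2)] by (auto simp: T_def)
  moreover have "spectrum quotient \<inter> insert 0 T = {}"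
    using zero_not_eigenvalue pivot_last_not_eigenvalue[of "- 1 / of_nat (deg 1)"]
      pivot_eq_0_iff[OF lt(2)] dom m by (auto simp: T_def)
  moreover have "finite (insert 0 T)" by (simp add: T_def)
  ultimately have "card (spectrum vertex_matrix) = m + card (insert 0 T)"
    by (rule card_spectrum_if_disjoint)
  moreover have "card (insert 0 T) = (if size 1 = 1 then 1 else 2)"
    using deg_pos[OF lt(2)] by (simp add: T_def)
  ultimately show ?thesis using m by (simp del: One_nat_def split: if_splits)
qed

lemma card_spectrum_3_cells:
  assumes m: "m = 3"
  shows "if size 1 = 1 \<and> size 2 = 1 then card (spectrum vertex_matrix) = 4
    else 5 \<le> card (spectrum vertex_matrix)"
proof -
  have lt: "0 < m" "1 < m" "2 < m" and all: "k < m \<longleftrightarrow> k = 0 \<or> k = 1 \<or> k = 2" for k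
    using m by auto
  have dom: "dominating 0" "\<not> dominating 1" "dominating 2"
    unfolding dominating_def using m by simp_all
  define a where "a = (- 1 / of_nat (deg 0) :: complex)"
  define c where "c = (- 1 / of_nat (deg 2) :: complex)"
  define T where "T = (if size 1 = 1 then {} else {0}) \<union> (if size 2 = 1 then {} else {c})"
  have ac: "a \<noteq> c" "a \<noteq> 0" "c \<noteq> 0"
    using deg_less[of 0 2] lt dom deg_pos by (auto simp: a_def c_def)
  \<comment> \<open>\<open>T\<close> is the contribution of cells 1 and 2; cell 0 contributes \<open>a\<close>.\<close>
  have "spectrum vertex_matrix = spectrum quotient \<union> insert a T"
    unfolding spectrum_vertex_matrix all
    using pivot_eq_0_iff lt dom size_0 size_pos[OF lt(2)] size_pos[OF lt(3)]
    by (auto simp: T_def a_def c_def)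
  moreover have "spectrum quotient \<inter> insert a T = {}"
    using zero_not_eigenvalue pivot_last_not_eigenvalue[of c] pivot_0_not_eigenvalue_if_3_cells[OF m, of a]
      pivot_eq_0_iff[OF lt(1)] pivot_eq_0_iff[OF lt(3)] dom m by (auto simp: T_def a_def c_def)
  moreover have "finite (insert a T)" by (simp add: T_def)
  ultimately have "card (spectrum vertex_matrix) = m + card (insert a T)"
    by (rule card_spectrum_if_disjoint)
  moreover have "card (insert a T)
      = 1 + (if size 1 = 1 then 0 else 1) + (if size 2 = 1 then 0 else 1)"
    using ac by (auto simp: T_def)
  ultimately show ?thesis using m by (simp del: One_nat_def split: if_splits)
qed

lemma card_spectrum_4_cells:
  assumes m: "m = 4"
  shows "5 \<le> card (spectrum vertex_matrix)"
proof -
  have "\<not> dominating 0" unfolding dominating_def using m by simp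
  then have "insert 0 (spectrum quotient) \<subseteq> spectrum vertex_matrix"
    unfolding spectrum_vertex_matrix using pivot_eq_0_iff[OF m_pos] size_0 m_pos by auto
  from card_mono[OF finite_spectrum_vertex_matrix this] show ?thesis
    using zero_not_eigenvalue finite_spectrum_quotient card_spectrum_quotient m by simp
qed

lemma cells_le_card_spectrum: "m \<le> card (spectrum vertex_matrix)"
  using card_mono[OF finite_spectrum_vertex_matrix spectrum_quotient_subset]
    card_spectrum_quotient by simp

end

section \<open>The cells of a binary string\<close>

text \<open>
  \<open>run b i\<close> is the number of the cell that contains the vertex with index \<open>i\<close>. The comparison of
  the letters 0 and 1 is skipped, so the first letter is read as if it were equal to the second.
\<close>

primrec run :: "bool list \<Rightarrow> nat \<Rightarrow> nat" where
  "run b 0 = 0"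
| "run b (Suc i) = run b i + (if 0 < i \<and> b ! i \<noteq> b ! Suc i then 1 else 0)"

lemma mono_run: "mono (run b)"
  by (simp add: mono_iff_le_Suc)

lemma run_le: "i \<le> j \<Longrightarrow> run b i \<le> run b j"
  using mono_run by (rule monoD)

lemma run_surj: "k \<le> run b i \<Longrightarrow> \<exists>j\<le>i. run b j = k"
proof (induction i)
  case (Suc i)
  then show ?case by (cases "k \<le> run b i") (auto simp: le_Suc_eq split: if_splits)
qed simp

lemma even_run_iff: "0 < i \<Longrightarrow> even (run b i) \<longleftrightarrow> b ! i = b ! 1"
proof (induction i)
  case (Suc i)
  then show ?case by (cases "i = 0") auto
qed simp

text \<open>
  The right-hand side is the predicate \<open>dominating\<close> for the cell of \<open>i\<close> among
  \<open>Suc (run b (n - 1))\<close> cells.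
\<close>

lemma nth_iff_odd_run:
  assumes "0 < i" "i < n" "b ! (n - 1)"
  shows "b ! i \<longleftrightarrow> odd (Suc (run b (n - 1)) - run b i)"
proof -
  have "even (run b (n - 1)) \<longleftrightarrow> b ! (n - 1) = b ! 1" "even (run b i) \<longleftrightarrow> b ! i = b ! 1"
    using assms by (auto simp: even_run_iff simp del: One_nat_def)
  moreover have "run b i \<le> run b (n - 1)" using assms by (intro run_le) simp
  ultimately show ?thesis using assms(3) by (auto simp: Suc_diff_le)
qed

text \<open>
  The letters change exactly where \<open>run\<close> increases, so the last letter and \<open>run\<close> determine all
  letters but the first.
\<close>

lemma string_eq_iff_run_eq:
  assumes "length b = n" "length c = n" "b ! 0 = c ! 0" "b ! (n - 1)" "c ! (n - 1)"
  shows "b = c \<longleftrightarrow> (\<forall>i<n. run b i = run c i)"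
proof
  assume run: "\<forall>i<n. run b i = run c i"
  show "b = c"
  proof (rule nth_equalityI)
    fix i assume i: "i < length b"
    show "b ! i = c ! i"
    proof (cases "i = 0")
      case False
      then show ?thesis
        using nth_iff_odd_run[of i n b] nth_iff_odd_run[of i n c] run i assms by simp
    qed (use assms in simp)
  qed (use assms in simp)
qed simp

lemma run_zeros_ones:
  assumes "2 \<le> s" "i < n"
  shows "run (zeros s @ ones (n - s)) i = (if i < s then 0 else 1)"
  using assms(2)
proof (induction i)
  case (Suc i)
  then show ?case using assms(1) by (auto simp: nth_append not_less less_Suc_eq)
qed (use assms in simp)

lemma run_zero_ones:
  assumes "i < n"
  shows "run (zeros 1 @ ones (n - 1)) i = 0"
  using assms by (induction i) (auto simp: nth_Cons')

lemma run_zero_ones_zero_one: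
  assumes "4 \<le> n" "i < n"
  shows "run (zeros 1 @ ones (n - 3) @ zeros 1 @ ones 1) i
    = (if i < n - 2 then 0 else if i = n - 2 then 1 else 2)"
proof -
  let ?c = "zeros 1 @ ones (n - 3) @ zeros 1 @ ones 1"
  have nth: "?c ! i \<longleftrightarrow> i \<noteq> 0 \<and> i \<noteq> n - 2" if "i < n" for i
    using that assms(1) by (auto simp: nth_append nth_Cons')
  show ?thesis
    using assms(2)
  proof (induction i)
    case (Suc i)
    have "?c ! i \<longleftrightarrow> i \<noteq> 0 \<and> i \<noteq> n - 2" "?c ! Suc i \<longleftrightarrow> Suc i \<noteq> n - 2"
      using nth[of i] nth[of "Suc i"] Suc.prems by auto
    then show ?case
      unfolding run.simps using Suc assms(1) by auto
  qed (use assms in simp)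
qed

definition run_size :: "bool list \<Rightarrow> nat \<Rightarrow> nat" where
  "run_size b k = card {i. i < length b \<and> run b i = k}"

lemma threshold_cells_run:
  assumes n: "2 \<le> length b"
  shows "threshold_cells (Suc (run b (length b - 1))) (run_size b) (length b) (run b)"
proof
  show "0 < run_size b k" if "k < Suc (run b (length b - 1))" for k
  proof -
    have "k \<le> run b (length b - 1)" using that by simp
    from run_surj[OF this] obtain j where "j \<le> length b - 1" "run b j = k" by blast
    then show ?thesis using n by (auto simp: run_size_def card_gt_0_iff intro!: exI[of _ j])
  qed
  have "card {0, 1 :: nat} \<le> run_size b 0"
    unfolding run_size_def by (rule card_mono) (use n in auto)
  then show "2 \<le> run_size b 0" by simp
  show "run b i < Suc (run b (length b - 1))" if "i < length b" for i
    using run_le[of i "length b - 1" b] that by linarith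
qed (simp_all add: run_size_def)

lemma normalized_adjacency_matrix_threshold_graph:
  assumes n: "2 \<le> length b" and last: "b ! (length b - 1)"
  shows "normalized_adjacency_matrix (threshold_graph b) =
    threshold_cells.vertex_matrix (Suc (run b (length b - 1))) (run_size b) (length b) (run b)"
proof -
  define n where "n = length b"
  interpret threshold_cells "Suc (run b (n - 1))" "run_size b" n "run b"
    unfolding n_def by (rule threshold_cells_run[OF n])
  have adj: "b ! max i j \<longleftrightarrow> dominating (max (run b i) (run b j))" if "i \<noteq> j" "i < n" "j < n" for i j
  proof -
    have "b ! max i j \<longleftrightarrow> odd (Suc (run b (n - 1)) - run b (max i j))"
      by (rule nth_iff_odd_run) (use that last in \<open>auto simp: n_def\<close>)
    then show ?thesis unfolding dominating_def max_of_mono[OF mono_run] .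
  qed
  have deg: "out_degree (with_proj (threshold_graph b)) (Suc i) = deg (run b i)" if i: "i < n" for i
  proof -
    have "out_arcs (with_proj (threshold_graph b)) (Suc i)
        = (\<lambda>j. (Suc i, Suc j)) ` {j. j < n \<and> i \<noteq> j \<and> dominating (max (run b i) (run b j))}"
    proof (intro equalityI subsetI)
      fix e assume "e \<in> out_arcs (with_proj (threshold_graph b)) (Suc i)"
      then obtain v where v: "e = (Suc i, v)" "1 \<le> v" "v \<le> n" "Suc i \<noteq> v" "b ! (max (Suc i) v - 1)"
        by (auto simp: out_arcs_def parcs_threshold_graph n_def)
      then obtain j where j: "v = Suc j" by (cases v) auto
      then show "e \<in> (\<lambda>j. (Suc i, Suc j)) ` {j. j < n \<and> i \<noteq> j \<and> dominating (max (run b i) (run b j))}"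
        using v adj[of i j] i by auto
    next
      fix e assume "e \<in> (\<lambda>j. (Suc i, Suc j)) ` {j. j < n \<and> i \<noteq> j \<and> dominating (max (run b i) (run b j))}"
      then show "e \<in> out_arcs (with_proj (threshold_graph b)) (Suc i)"
        using adj i by (auto simp: out_arcs_def parcs_threshold_graph n_def)
    qed
    then show ?thesis
      using card_neighbours[OF i] by (simp add: out_degree_def card_image inj_on_def)
  qed
  have n': "card (pverts (threshold_graph b)) = n" by (simp add: pverts_threshold_graph n_def)
  have "normalized_adjacency_matrix (threshold_graph b) = mat n n (\<lambda>(i, j).
      if (Suc i, Suc j) \<in> parcs (threshold_graph b)
      then 1 / of_nat (out_degree (with_proj (threshold_graph b)) (Suc i)) else 0)"
    using normalized_adjacency_matrix_entries[of "threshold_graph b"] deg deg_pos[OF cell_less]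
    unfolding n' by auto
  also have "\<dots> = vertex_matrix"
    unfolding vertex_matrix_def
    by (rule eq_matI) (use adj deg in \<open>auto simp: parcs_threshold_graph n_def[symmetric]\<close>)
  finally show ?thesis unfolding n_def .
qed

text \<open>
  A last letter 0 would make the last vertex isolated, whereas it can reach vertex 1.
\<close>

lemma last_True_if_connected:
  assumes n: "2 \<le> length b" and conn: "Digraph_Component.connected (with_proj (threshold_graph b))"
  shows "b ! (length b - 1)"
proof -
  let ?n = "length b" and ?G = "mk_symmetric (with_proj (threshold_graph b))"
  have "?n \<rightarrow>\<^sup>*\<^bsub>with_proj ?G\<^esub> 1"
    using conn n unfolding connected_def
    by (auto simp: strongly_connected_def mk_symmetric_def pverts_threshold_graph)
  then have "(?n, 1) \<in> (arcs_ends (with_proj ?G))\<^sup>*" by (rule reachable_rtranclI)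
  then obtain v where "(?n, v) \<in> arcs_ends (with_proj ?G)"
    using n by (cases rule: converse_rtranclE) auto
  then have "(?n, v) \<in> parcs ?G" by (auto simp: arcs_ends_def arc_to_ends_def)
  then have "(?n, v) \<in> parcs (threshold_graph b) \<or> (v, ?n) \<in> parcs (threshold_graph b)"
    by (auto simp: mk_symmetric_def)
  then show ?thesis by (auto simp: parcs_threshold_graph max_def split: if_splits)
qed

section \<open>Strings with at most three cells\<close>

lemma one_run_iff:
  assumes "length b = n" "2 \<le> n" "b ! 0 = False" "b ! (n - 1)"
  shows "run b (n - 1) = 0 \<longleftrightarrow> b = zeros 1 @ ones (n - 1)"
proof -
  have "run b (n - 1) = 0 \<longleftrightarrow> (\<forall>i<n. run b i = 0)"
    using run_le[of _ "n - 1" b] assms(2) by fastforce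
  also have "\<dots> \<longleftrightarrow> (\<forall>i<n. run b i = run (zeros 1 @ ones (n - 1)) i)"
    using run_zero_ones by auto
  also have "\<dots> \<longleftrightarrow> b = zeros 1 @ ones (n - 1)"
    by (rule string_eq_iff_run_eq[symmetric]) (use assms in \<open>auto simp: nth_append\<close>)
  finally show ?thesis .
qed

lemma zeros_ones_iff_run:
  assumes "length b = n" "b ! 0 = False" "b ! (n - 1)" "2 \<le> s" "s < n"
  shows "b = zeros s @ ones (n - s) \<longleftrightarrow> (\<forall>i<n. run b i = (if i < s then 0 else 1))"
proof -
  have "b = zeros s @ ones (n - s) \<longleftrightarrow> (\<forall>i<n. run b i = run (zeros s @ ones (n - s)) i)"
    by (rule string_eq_iff_run_eq) (use assms in \<open>auto simp: nth_append\<close>)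
  then show ?thesis using run_zeros_ones[OF assms(4)] by simp
qed

lemma two_runs_if_zeros_ones:
  assumes "length b = n" "b ! 0 = False" "b ! (n - 1)" "2 \<le> s" "s < n"
    and b: "b = zeros s @ ones (n - s)"
  shows "run b (n - 1) = 1 \<and> run_size b 1 = n - s"
proof -
  have run: "run b i = (if i < s then 0 else 1)" if "i < n" for i
    using zeros_ones_iff_run[OF assms(1-5)] b that by simp
  have "{i. i < length b \<and> run b i = 1} = {s..<n}"
    using run assms(1) by (auto split: if_splits)
  then show ?thesis using run[of "n - 1"] assms(5) by (simp add: run_size_def)
qed

lemma zeros_ones_if_two_runs:
  assumes b: "length b = n" "b ! 0 = False" "b ! (n - 1)" "2 \<le> n" and run: "run b (n - 1) = 1"
  obtains s where "2 \<le> s" "s < n" "b = zeros s @ ones (n - s)"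
proof -
  define s where "s = (LEAST i. run b i = 1)"
  have s: "run b s = 1" unfolding s_def using run by (rule LeastI)
  have le: "s \<le> n - 1" unfolding s_def using run by (rule Least_le)
  have "run b 0 = 0" "run b 1 = 0" by simp_all
  with s have "s \<noteq> 0" "s \<noteq> 1" by (metis zero_neq_one)+
  then have s2: "2 \<le> s" by linarith
  have "run b i = (if i < s then 0 else 1)" if "i < n" for i
  proof -
    have "run b i \<le> 1" using run_le[of i "n - 1" b] run that by simp
    moreover have "run b i \<noteq> 1" if "i < s" using not_less_Least that unfolding s_def by blast
    moreover have "1 \<le> run b i" if "\<not> i < s" using run_le[of s i b] s that by simp
    ultimately show ?thesis by (cases "i < s") fastforce+
  qed
  then have "b = zeros s @ ones (n - s)"
    using zeros_ones_iff_run[OF b(1-3) s2] le b(4) by simp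
  with s2 le b(4) show ?thesis by (intro that[of s]) auto
qed

text \<open>
  As \<open>run\<close> is monotone, the runs 1 and 2 of length one can only be the last two positions. The
  condition \<open>4 \<le> n\<close> expresses that run 0 has at least two positions.
\<close>

lemma three_runs_iff:
  assumes b: "length b = n" "b ! 0 = False" "b ! (n - 1)" "2 \<le> n"
  shows "run b (n - 1) = 2 \<and> run_size b 1 = 1 \<and> run_size b 2 = 1 \<longleftrightarrow>
    4 \<le> n \<and> b = zeros 1 @ ones (n - 3) @ zeros 1 @ ones 1" (is "?L \<longleftrightarrow> ?R")
proof -
  let ?r = "\<lambda>i. if i < n - 2 then 0 else if i = n - 2 then 1 else 2 :: nat"
  have R: "?R \<longleftrightarrow> 4 \<le> n \<and> (\<forall>i<n. run b i = ?r i)"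
  proof (cases "4 \<le> n")
    case True
    have "b = zeros 1 @ ones (n - 3) @ zeros 1 @ ones 1 \<longleftrightarrow>
        (\<forall>i<n. run b i = run (zeros 1 @ ones (n - 3) @ zeros 1 @ ones 1) i)"
      by (rule string_eq_iff_run_eq) (use b True in \<open>auto simp: nth_append nth_Cons'\<close>)
    then show ?thesis using run_zero_ones_zero_one[OF True] True by simp
  qed simp
  have "\<forall>i<n. run b i = ?r i" "4 \<le> n" if L: ?L
  proof -
    have unique: "i = j" if "i < n" "j < n" "run b i = k" "run b j = k" "k = 1 \<or> k = 2" for i j k
    proof -
      have "card {i. i < n \<and> run b i = k} = 1" using L that(5) b(1) by (auto simp: run_size_def)
      then obtain a where a: "{i. i < n \<and> run b i = k} = {a}" by (rule card_1_singletonE)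
      have "i \<in> {a}" "j \<in> {a}" unfolding a[symmetric] using that by auto
      then show ?thesis by simp
    qed
    have "run b 0 = 0" "run b 1 = 0" by simp_all
    have "n \<noteq> 2" using L \<open>run b 1 = 0\<close> by (intro notI) simp
    then have n3: "3 \<le> n" using b(4) by linarith
    have le2: "run b i \<le> 2" if "i < n" for i using run_le[of i "n - 1" b] L that by simp
    have not2: "run b (n - 2) \<noteq> 2" using unique[of "n - 2" "n - 1" 2] L n3 by auto
    have "n - 1 = Suc (n - 2)" using n3 by simp
    then have "run b (n - 1) \<le> Suc (run b (n - 2))" by simp
    with not2 le2[of "n - 2"] L n3 have r1: "run b (n - 2) = 1" by simp
    with \<open>run b 1 = 0\<close> have "n - 2 \<noteq> 1" by (metis zero_neq_one)
    with n3 show "4 \<le> n" by simp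
    show "\<forall>i<n. run b i = ?r i"
    proof (intro allI impI)
      fix i assume i: "i < n"
      consider "i < n - 2" | "i = n - 2" | "i = n - 1" using i by linarith
      then show "run b i = ?r i"
      proof cases
        case 1
        have "run b i \<noteq> 1" using unique[of i "n - 2" 1] r1 1 i by auto
        moreover have "run b i \<noteq> 2" using unique[of i "n - 1" 2] L 1 i by auto
        ultimately show ?thesis using le2[OF i] 1 by simp
      next
        case 2
        then show ?thesis using r1 by simp
      next
        case 3
        then have "i \<noteq> n - 2" "\<not> i < n - 2" using n3 by linarith+
        moreover have "run b i = 2" using L 3 by simp
        ultimately show ?thesis by simp
      qed
    qed
  qed
  moreover have ?L if n: "4 \<le> n" and r: "\<forall>i<n. run b i = ?r i"
  proof -
    have v: "run b i = 1 \<longleftrightarrow> i = n - 2" "run b i = 2 \<longleftrightarrow> i = n - 1" if i: "i < n" for i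
    proof -
      consider "i < n - 2" | "i = n - 2" | "i = n - 1" using i by linarith
      then have "(run b i = 1 \<longleftrightarrow> i = n - 2) \<and> (run b i = 2 \<longleftrightarrow> i = n - 1)"
        using r[rule_format, OF i] n by cases auto
      then show "run b i = 1 \<longleftrightarrow> i = n - 2" "run b i = 2 \<longleftrightarrow> i = n - 1" by blast+
    qed
    have "{i. i < n \<and> run b i = 1} = {n - 2}" "{i. i < n \<and> run b i = 2} = {n - 1}"
      using n v by auto
    then show ?thesis using n v[of "n - 1"] b(1) by (simp add: run_size_def)
  qed
  ultimately show ?thesis unfolding R by blast
qed

section \<open>Normalized eigenvalues of connected threshold graphs\<close>

theorem theorem4p2:
  fixes \<Gamma> :: "nat pair_pre_digraph" and b :: "bool list" and n :: nat
  assumes "n \<ge> 2" and "length b = n" and "b ! 0 = False"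
    and "\<Gamma> = threshold_graph b"
    and "Digraph_Component.connected (with_proj \<Gamma>)"
  shows
    "(card (normalized_eigenvalues \<Gamma>) = 2 \<longleftrightarrow> b = zeros 1 @ ones (n - 1)) \<and>
     (card (normalized_eigenvalues \<Gamma>) = 3 \<longleftrightarrow> n \<ge> 3 \<and> b = zeros (n - 1) @ ones 1) \<and>
     (card (normalized_eigenvalues \<Gamma>) = 4 \<longleftrightarrow>
        (\<exists>s. 1 < s \<and> s < n - 1 \<and> b = zeros s @ ones (n - s)) \<or>
        (n \<ge> 4 \<and> b = zeros 1 @ ones (n - 3) @ zeros 1 @ ones 1))"
proof -
  note b = assms(2,3)
  have last: "b ! (n - 1)"
    using last_True_if_connected[of b] assms by simp
  define N where "N = card (normalized_eigenvalues \<Gamma>)"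
  define R where "R = run b (n - 1)"
  interpret threshold_cells "Suc R" "run_size b" n "run b"
    unfolding R_def using threshold_cells_run[of b] assms(1,2) by simp
  have N: "N = card (spectrum vertex_matrix)"
    using normalized_adjacency_matrix_threshold_graph[of b] assms last
    by (simp add: N_def R_def normalized_eigenvalues_def)
  consider "R = 0" | "R = 1" | "R = 2" | "3 \<le> R" by linarith
  then have count: "(N = 2 \<longleftrightarrow> R = 0) \<and> (N = 3 \<longleftrightarrow> R = 1 \<and> run_size b 1 = 1) \<and>
    (N = 4 \<longleftrightarrow> R = 1 \<and> run_size b 1 \<noteq> 1 \<or> R = 2 \<and> run_size b 1 = 1 \<and> run_size b 2 = 1)"
  proof cases
    case 1
    then show ?thesis using card_spectrum_1_cell N by simp
  next
    case 2
    then show ?thesis using card_spectrum_2_cells N by (simp split: if_splits)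
  next
    case 3
    then show ?thesis using card_spectrum_3_cells N by (simp split: if_splits)
  next
    case 4
    then have "5 \<le> N"
      using card_spectrum_4_cells cells_le_card_spectrum N by (cases "R = 3") auto
    then show ?thesis using 4 by simp
  qed
  have two: "R = 1 \<and> run_size b 1 = k \<longleftrightarrow> (\<exists>s. 2 \<le> s \<and> s < n \<and> n - s = k \<and> b = zeros s @ ones (n - s))"
    for k
    using zeros_ones_if_two_runs[OF b last assms(1)] two_runs_if_zeros_ones[OF b last]
    unfolding R_def by metis
  have "R = 1 \<and> run_size b 1 = 1 \<longleftrightarrow> n \<ge> 3 \<and> b = zeros (n - 1) @ ones 1"
  proof -
    have "(2 \<le> s \<and> s < n \<and> n - s = 1 \<and> b = zeros s @ ones (n - s)) \<longleftrightarrow>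
      s = n - 1 \<and> n \<ge> 3 \<and> b = zeros (n - 1) @ ones 1" for s
    proof (cases "s = n - 1")
      case True
      then show ?thesis using assms(1) by (auto simp: numeral_eq_Suc)
    next
      case False
      then show ?thesis by auto
    qed
    then show ?thesis unfolding two by blast
  qed
  moreover have "R = 1 \<and> run_size b 1 \<noteq> 1 \<longleftrightarrow>
      (\<exists>s. 1 < s \<and> s < n - 1 \<and> b = zeros s @ ones (n - s))"
  proof -
    have "R = 1 \<and> run_size b 1 \<noteq> 1 \<longleftrightarrow> (\<exists>k. k \<noteq> 1 \<and> R = 1 \<and> run_size b 1 = k)" by blast
    also have "\<dots> \<longleftrightarrow> (\<exists>s. (2 \<le> s \<and> s < n \<and> n - s \<noteq> 1) \<and> b = zeros s @ ones (n - s))"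
      unfolding two by blast
    also have "\<dots> \<longleftrightarrow> (\<exists>s. 1 < s \<and> s < n - 1 \<and> b = zeros s @ ones (n - s))"
      by (intro ex_cong1) auto
    finally show ?thesis .
  qed
  moreover note one_run_iff[OF b(1) assms(1) b(2) last, folded R_def]
    three_runs_iff[OF b last assms(1), folded R_def]
  ultimately show ?thesis using count unfolding N_def by simp
qed

end
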